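(* Let $m\ge 2$ and $q_r=\max_i\min\{r_i,m-1\}$. Every output $\mu$ of the capacity-constrained maximum-edge round algorithm is a capacity-EF1 matching and satisfies $$\alpha_r(\mu)\ge\frac{1}{1+q_r},\qquad \frac{\mathrm{SW}(\mu)}{\mathrm{OPT}_r}\ge\frac{1}{1+q_r}.$$ If every worker with $M_j>0$ is assigned in $\mu$ to a real firm along a positive edge (i.e. $a_{\mu(j)j}>0$), then with $t=\delta(A)$, $$\min\left\{\alpha_r(\mu),\frac{\mathrm{SW}(\mu)}{\mathrm{OPT}_r}\right\}\ge\Gamma_{m,r}(t):=\max\left\{t,\frac{1}{1+q_r(1-t)}\right\}.$$ (The welfare ratios are considered when $\mathrm{OPT}_r>0$.)
   Context: Market: firms $F=\{1,\dots,m\}$, workers $W=\{1,\dots,n\}$, values $A=(a_{ij})$, $a_{ij}\ge 0$, additive: $V_i(T)=\sum_{j\in T}a_{ij}$. $M_j=\max_i a_{ij}$. If some $a_{ij}>0$, $\delta(A)=\min_{a_{ij}>0}a_{ij}/M_j$; for the all-zero market $\delta(A)=1$. Firm $i$ has capacity $r_i\in\mathbb Z_+$. A capacity-feasible matching $\mu$ assigns pairwise disjoint sets $\mu(i)\subseteq W$ to firms with $|\mu(i)|\le r_i$; unmatched workers are treated as assigned to a zero-value dummy node. $B_i=V_i(\mu(i))$, $\mathrm{SW}(\mu)=\sum_i B_i$, and $\mathrm{OPT}_r$ is the maximum of $\mathrm{SW}$ over capacity-feasible matchings. Capacity EF1: for every pair of firms $i,k$ with $\mu(k)\ne\varnothing$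 there is $g\in\mu(k)$ with $V_i(\mu(i))\ge\max\{V_i(T):T\subseteq\mu(k)\setminus\{g\},\ |T|\le r_i\}$. Core: for $I\subseteq F$, $T\subseteq W$, $v_r(I,T)$ is the maximum total value obtainable by assigning workers in $T$ to firms in $I$ (each worker to at most one firm), each firm $i\in I$ receiving at most $r_i$ workers. Payments $x_i\ge 0$, $y_j\ge 0$ satisfy local financing if $x_i+\sum_{j\in\mu(i)}y_j=B_i$ for every firm $i$ and $y_j=0$ for every unmatched worker. $(\mu,x,y)$ is in the $\alpha$-core if $\sum_{i\in I}x_i+\sum_{j\in T}y_j\ge\alpha\,v_r(I,T)$ for all $I\subseteq F$, $T\subseteq W$. $\alpha_r(\mu)$ is the largest $\alpha$ (supremum in $[0,+\infty]$) for which nonnegative payments satisfying local financing put $(\mu,x,y)$ in the $\alpha$-core. Capacity-constrained maximum-edge round algorithm: start with $\mu(i)=\varnothing$, remaining capacities $c_i=r_i$, $U=W$. While there are $i,j$ with $c_i>0$, $j\in U$, $a_{ij}>0$: start a new round with $S=\{i:c_i>0\}$; while there are $i\in S$, $j\in U$ with $a_{ij}>0$, choose (ties arbitrary) $(i^*,j^* )\in S\times U$ maximizing $a_{ij}$ over $S\times U$, add $j^*$ to $\mu(i^* )$, decrease $c_{i^*}$ by 1, remove $j^*$ from $U$ and $i^*$ from $S$. Finally leave remaining workers unmatched (assigned to the dummy node). *)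

theory Defs
  imports "HOL-Library.Extended_Real" "HOL-Library.Disjoint_Sets"
begin

abbreviation (input) firms :: "nat \<Rightarrow> nat set" where "firms m \<equiv> {1..m}"
abbreviation (input) workers :: "nat \<Rightarrow> nat set" where "workers n \<equiv> {1..n}"

definition value_of :: "(nat \<Rightarrow> nat \<Rightarrow> real) \<Rightarrow> nat \<Rightarrow> nat set \<Rightarrow> real" where
  "value_of a i T = (\<Sum>j\<in>T. a i j)"

definition max_value :: "nat \<Rightarrow> (nat \<Rightarrow> nat \<Rightarrow> real) \<Rightarrow> nat \<Rightarrow> real" where
  "max_value m a j = Max ((\<lambda>i. a i j) ` firms m)"

definition delta :: "nat \<Rightarrow> nat \<Rightarrow> (nat \<Rightarrow> nat \<Rightarrow> real) \<Rightarrow> real" where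
  "delta m n a =
     (if \<exists>i\<in>firms m. \<exists>j\<in>workers n. a i j > 0
      then Min {a i j / max_value m a j | i j. i \<in> firms m \<and> j \<in> workers n \<and> a i j > 0}
      else 1)"

text \<open>
  Workers in no set \<open>\<nu> i\<close> are unassigned. The values of \<open>\<nu>\<close> outside \<open>I\<close> are irrelevant.
\<close>

definition feasible_assignment ::
  "(nat \<Rightarrow> nat) \<Rightarrow> nat set \<Rightarrow> nat set \<Rightarrow> (nat \<Rightarrow> nat set) \<Rightarrow> bool" where
  "feasible_assignment r I T \<nu> \<longleftrightarrow>
     (\<forall>i\<in>I. \<nu> i \<subseteq> T \<and> card (\<nu> i) \<le> r i) \<and> disjoint_family_on \<nu> I"

definition feasible_matching ::
  "nat \<Rightarrow> nat \<Rightarrow> (nat \<Rightarrow> nat) \<Rightarrow> (nat \<Rightarrow> nat set) \<Rightarrow> bool" where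
  "feasible_matching m n r \<mu> \<longleftrightarrow> feasible_assignment r (firms m) (workers n) \<mu>"

definition social_welfare ::
  "nat \<Rightarrow> (nat \<Rightarrow> nat \<Rightarrow> real) \<Rightarrow> (nat \<Rightarrow> nat set) \<Rightarrow> real" where
  "social_welfare m a \<mu> = (\<Sum>i\<in>firms m. value_of a i (\<mu> i))"

definition opt_welfare ::
  "nat \<Rightarrow> nat \<Rightarrow> (nat \<Rightarrow> nat \<Rightarrow> real) \<Rightarrow> (nat \<Rightarrow> nat) \<Rightarrow> real" where
  "opt_welfare m n a r = Max {social_welfare m a \<mu> | \<mu>. feasible_matching m n r \<mu>}"

definition capacity_EF1 ::
  "nat \<Rightarrow> (nat \<Rightarrow> nat \<Rightarrow> real) \<Rightarrow> (nat \<Rightarrow> nat) \<Rightarrow> (nat \<Rightarrow> nat set) \<Rightarrow> bool" where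
  "capacity_EF1 m a r \<mu> \<longleftrightarrow>
     (\<forall>i\<in>firms m. \<forall>k\<in>firms m. \<mu> k \<noteq> {} \<longrightarrow>
        (\<exists>g\<in>\<mu> k. value_of a i (\<mu> i)
           \<ge> Max {value_of a i T | T. T \<subseteq> \<mu> k - {g} \<and> card T \<le> r i}))"

definition coalition_value ::
  "(nat \<Rightarrow> nat \<Rightarrow> real) \<Rightarrow> (nat \<Rightarrow> nat) \<Rightarrow> nat set \<Rightarrow> nat set \<Rightarrow> real" where
  "coalition_value a r I T =
     Max {\<Sum>i\<in>I. value_of a i (\<nu> i) | \<nu>. feasible_assignment r I T \<nu>}"

definition nonneg_payments ::
  "nat \<Rightarrow> nat \<Rightarrow> (nat \<Rightarrow> real) \<Rightarrow> (nat \<Rightarrow> real) \<Rightarrow> bool" where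
  "nonneg_payments m n x y \<longleftrightarrow> (\<forall>i\<in>firms m. 0 \<le> x i) \<and> (\<forall>j\<in>workers n. 0 \<le> y j)"

definition local_financing ::
  "nat \<Rightarrow> nat \<Rightarrow> (nat \<Rightarrow> nat \<Rightarrow> real) \<Rightarrow> (nat \<Rightarrow> nat set) \<Rightarrow>
   (nat \<Rightarrow> real) \<Rightarrow> (nat \<Rightarrow> real) \<Rightarrow> bool" where
  "local_financing m n a \<mu> x y \<longleftrightarrow>
     (\<forall>i\<in>firms m. x i + (\<Sum>j\<in>\<mu> i. y j) = value_of a i (\<mu> i)) \<and>
     (\<forall>j\<in>workers n. j \<notin> (\<Union>i\<in>firms m. \<mu> i) \<longrightarrow> y j = 0)"

definition in_core ::
  "nat \<Rightarrow> nat \<Rightarrow> (nat \<Rightarrow> nat \<Rightarrow> real) \<Rightarrow> (nat \<Rightarrow> nat) \<Rightarrow>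
   real \<Rightarrow> (nat \<Rightarrow> real) \<Rightarrow> (nat \<Rightarrow> real) \<Rightarrow> bool" where
  "in_core m n a r \<alpha> x y \<longleftrightarrow>
     (\<forall>I T. I \<subseteq> firms m \<and> T \<subseteq> workers n \<longrightarrow>
        (\<Sum>i\<in>I. x i) + (\<Sum>j\<in>T. y j) \<ge> \<alpha> * coalition_value a r I T)"

text \<open>
  The supremum is extended-real valued because it is infinite when every coalition value is zero.
  For nonnegative \<open>a\<close> it is never \<open>-\<infinity>\<close>: paying each firm its whole value shows that
  \<open>\<alpha> = 0\<close> is attainable.
\<close>

definition core_ratio ::
  "nat \<Rightarrow> nat \<Rightarrow> (nat \<Rightarrow> nat \<Rightarrow> real) \<Rightarrow> (nat \<Rightarrow> nat) \<Rightarrow> (nat \<Rightarrow> nat set) \<Rightarrow> ereal" where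
  "core_ratio m n a r \<mu> =
     Sup {ereal \<alpha> | \<alpha>. 0 \<le> \<alpha> \<and>
       (\<exists>x y. nonneg_payments m n x y \<and> local_financing m n a \<mu> x y \<and> in_core m n a r \<alpha> x y)}"

definition positive_edge :: "(nat \<Rightarrow> nat \<Rightarrow> real) \<Rightarrow> nat set \<Rightarrow> nat set \<Rightarrow> bool" where
  "positive_edge a S U \<longleftrightarrow> (\<exists>i\<in>S. \<exists>j\<in>U. a i j > 0)"

definition available_firms :: "nat \<Rightarrow> (nat \<Rightarrow> nat) \<Rightarrow> nat set" where
  "available_firms m c = {i \<in> firms m. c i > 0}"

text \<open>
  An algorithm state \<open>(\<mu>, c, U)\<close> consists of the partial matching, the remaining capacities
  and the unassigned workers; inside a round the set \<open>S\<close> of firms that may still receive a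
  worker is added in front. Both steps are relations because ties are broken arbitrarily.
\<close>

type_synonym alg_state = "(nat \<Rightarrow> nat set) \<times> (nat \<Rightarrow> nat) \<times> nat set"

inductive pick_step ::
  "(nat \<Rightarrow> nat \<Rightarrow> real) \<Rightarrow> nat set \<times> alg_state \<Rightarrow> nat set \<times> alg_state \<Rightarrow> bool"
  for a :: "nat \<Rightarrow> nat \<Rightarrow> real" where
  "\<lbrakk>positive_edge a S U; i \<in> S; j \<in> U; \<forall>i'\<in>S. \<forall>j'\<in>U. a i' j' \<le> a i j\<rbrakk>
   \<Longrightarrow> pick_step a (S, \<mu>, c, U)
         (S - {i}, \<mu>(i := insert j (\<mu> i)), c(i := c i - 1), U - {j})"

inductive round_step ::
  "nat \<Rightarrow> (nat \<Rightarrow> nat \<Rightarrow> real) \<Rightarrow> alg_state \<Rightarrow> alg_state \<Rightarrow> bool"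
  for m :: nat and a :: "nat \<Rightarrow> nat \<Rightarrow> real" where
  "\<lbrakk>positive_edge a (available_firms m c) U;
    (pick_step a)\<^sup>*\<^sup>* (available_firms m c, \<mu>, c, U) (S', \<mu>', c', U');
    \<not> positive_edge a S' U'\<rbrakk>
   \<Longrightarrow> round_step m a (\<mu>, c, U) (\<mu>', c', U')"

definition algorithm_output ::
  "nat \<Rightarrow> nat \<Rightarrow> (nat \<Rightarrow> nat \<Rightarrow> real) \<Rightarrow> (nat \<Rightarrow> nat) \<Rightarrow> (nat \<Rightarrow> nat set) \<Rightarrow> bool" where
  "algorithm_output m n a r \<mu> \<longleftrightarrow>
     (\<exists>c U. (round_step m a)\<^sup>*\<^sup>* (\<lambda>_. {}, r, workers n) (\<mu>, c, U) \<and>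
            \<not> positive_edge a (available_firms m c) U)"

definition capacity_parameter :: "nat \<Rightarrow> (nat \<Rightarrow> nat) \<Rightarrow> nat" where
  "capacity_parameter m r = Max ((\<lambda>i. min (r i) (m - 1)) ` firms m)"

definition Gamma_bound :: "nat \<Rightarrow> (nat \<Rightarrow> nat) \<Rightarrow> real \<Rightarrow> real" where
  "Gamma_bound m r t = max t (1 / (1 + real (capacity_parameter m r) * (1 - t)))"

end

theory Submission
  imports Defs
begin

text \<open>
  Let \<open>w j\<close> be the value at which worker \<open>j\<close> was matched (\<open>0\<close> if unmatched), and let \<open>B i\<close> be the
  value of firm \<open>i\<close>'s bundle. The workers of a set \<open>X\<close> with at most \<open>r i\<close> elements that firm \<open>i\<close>
  values above their weight were picked after \<open>i\<close> made its pick of the same round, or after \<open>i\<close> had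
  exhausted its capacity. Charging them to the picks of \<open>i\<close> bounds their value by
  \<open>min (r i) (m - 1) * B i\<close>, so \<open>V i X \<le> w X + (1 - t) * q * B i\<close> as soon as every weight is at
  least \<open>t\<close> times each value of the worker. The payments \<open>y = \<theta> * w\<close>, \<open>x = (1 - \<theta>) * B\<close> with
  \<open>\<theta> = 1 / (1 + q * (1 - t))\<close> then lie in the \<open>\<theta>\<close>-core, those with \<open>\<theta> = 1\<close> lie in the \<open>t\<close>-core,
  and the grand coalition gives the welfare bounds.
\<close>

section \<open>A charging inequality for finite sums\<close>

text \<open>Each \<open>g\<close> in \<open>H\<close> offers \<open>d\<close> slots of value
  \<open>h g\<close>. The elements of \<open>X\<close> occupy slots through \<open>f\<close>, at
  most \<open>d\<close> at each \<open>g\<close>, and the elements of \<open>Y\<close> fit into the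
  free slots in any order because each is worth at most the cheapest slot.\<close>

lemma sum_le_by_charging:
  fixes v :: "'a \<Rightarrow> real" and h :: "'b \<Rightarrow> real"
  assumes fin: "finite X" "finite Y" "finite H" and disj: "X \<inter> Y = {}"
    and h0: "\<And>g. g \<in> H \<Longrightarrow> 0 \<le> h g"
    and f: "\<And>j. j \<in> X \<Longrightarrow> f j \<in> H" "\<And>j. j \<in> X \<Longrightarrow> v j \<le> h (f j)"
    and fibre: "\<And>g. g \<in> H \<Longrightarrow> card {j \<in> X. f j = g} \<le> d"
    and low: "\<And>j g. j \<in> Y \<Longrightarrow> g \<in> H \<Longrightarrow> v j \<le> h g"
    and card: "Y \<noteq> {} \<Longrightarrow> card X + card Y \<le> d * card H"
  shows "sum v (X \<union> Y) \<le> real d * sum h H"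
proof -
  define k where "k g = card {j \<in> X. f j = g}" for g
  have "f ` X \<subseteq> H" using f by blast
  note grp = sum.group[OF fin(1) fin(3) this]
  have kX: "card X = sum k H"
    using grp[of "\<lambda>_. 1::nat"] by (simp add: k_def)
  have "sum v X \<le> (\<Sum>j\<in>X. h (f j))"
    by (intro sum_mono f)
  also have "\<dots> = (\<Sum>g\<in>H. real (k g) * h g)"
    unfolding grp[of "\<lambda>j. h (f j)", symmetric] k_def by (intro sum.cong) auto
  finally have X: "sum v X \<le> (\<Sum>g\<in>H. real (k g) * h g)" .
  have Y: "sum v Y \<le> (\<Sum>g\<in>H. (real d - real (k g)) * h g)"
  proof (cases "Y = {}")
    case True
    then show ?thesis
      using fibre h0 by (auto simp: k_def intro!: sum_nonneg mult_nonneg_nonneg)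
  next
    case False
    then have "H \<noteq> {}" using card[OF False] fin by auto
    \<comment> \<open>\<open>b\<close> is the cheapest slot value: it bounds every element of
      \<open>Y\<close>, and lowering all free slots to \<open>b\<close> only weakens the right-hand
      side.\<close>
    define b where "b = Min (h ` H)"
    have b: "b \<le> h g" if "g \<in> H" for g using that fin by (simp add: b_def)
    have "b \<in> h ` H" unfolding b_def using fin \<open>H \<noteq> {}\<close> by (intro Min_in) auto
    then obtain g0 where g0: "g0 \<in> H" "h g0 = b" by blast
    have "sum v Y \<le> real (card Y) * b"
      using sum_bounded_above[of Y v b] low g0 by force
    also have "\<dots> \<le> (real d * real (card H) - real (card X)) * b"
    proof (rule mult_right_mono)
      have "real (card X + card Y) \<le> real (d * card H)"
        using card[OF False] by (rule of_nat_mono)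
      then show "real (card Y) \<le> real d * real (card H) - real (card X)" by simp
    qed (use g0 h0 in force)
    also have "\<dots> = (\<Sum>g\<in>H. (real d - real (k g)) * b)"
      by (simp add: kX sum_subtractf flip: sum_distrib_right)
    also have "\<dots> \<le> (\<Sum>g\<in>H. (real d - real (k g)) * h g)"
      using fibre b by (intro sum_mono mult_left_mono) (auto simp: k_def)
    finally show ?thesis .
  qed
  have "sum v (X \<union> Y) = sum v X + sum v Y"
    using fin disj by (simp add: sum.union_disjoint)
  also have "\<dots> \<le> (\<Sum>g\<in>H. real (k g) * h g) + (\<Sum>g\<in>H. (real d - real (k g)) * h g)"
    using X Y by simp
  also have "\<dots> = real d * sum h H"
    by (simp add: sum_distrib_left algebra_simps flip: sum.distrib)
  finally show ?thesis .
qed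

section \<open>Invariants of the round algorithm\<close>

text \<open>
  \<open>\<rho> j\<close> is the round in which worker \<open>j\<close> was picked, and \<open>U\<close> is the set of unmatched workers.
\<close>

locale round_matching =
  fixes m n :: nat and a :: "nat \<Rightarrow> nat \<Rightarrow> real" and r :: "nat \<Rightarrow> nat"
    and \<mu> :: "nat \<Rightarrow> nat set" and \<rho> :: "nat \<Rightarrow> nat" and U :: "nat set"
  assumes matched: "(\<Union>i\<in>firms m. \<mu> i) = workers n - U"
    and unmatched: "U \<subseteq> workers n"
    and disj: "disjoint_family_on \<mu> (firms m)"
    and capacity: "i \<in> firms m \<Longrightarrow> card (\<mu> i) \<le> r i"
    and inj: "i \<in> firms m \<Longrightarrow> inj_on \<rho> (\<mu> i)"
    and later_le: "\<lbrakk>i \<in> firms m; k \<in> firms m; h \<in> \<mu> i; j \<in> \<mu> k; \<rho> h < \<rho> j\<rbrakk> \<Longrightarrow> a i j \<le> a i h"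
    and unmatched_le: "\<lbrakk>i \<in> firms m; h \<in> \<mu> i; j \<in> U\<rbrakk> \<Longrightarrow> a i j \<le> a i h"
    and outbid: "\<lbrakk>i \<in> firms m; k \<in> firms m; j \<in> \<mu> k; a k j < a i j\<rbrakk> \<Longrightarrow>
      (\<exists>h\<in>\<mu> i. \<rho> h = \<rho> j \<and> a i j \<le> a i h) \<or> card (\<mu> i) = r i \<and> (\<forall>h\<in>\<mu> i. \<rho> h < \<rho> j)"
    and previous: "\<lbrakk>i \<in> firms m; k \<in> firms m; j \<in> \<mu> k; \<rho> j = Suc p; 0 < a i j\<rbrakk> \<Longrightarrow>
      (\<exists>h\<in>\<mu> i. \<rho> h = p) \<or> card (\<mu> i) = r i \<and> (\<forall>h\<in>\<mu> i. \<rho> h < \<rho> j)"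
begin

lemma finite_bundle: "i \<in> firms m \<Longrightarrow> finite (\<mu> i)"
  using matched by (metis UN_upper finite_Diff finite_atLeastAtMost finite_subset)

lemma bundle_subset: "i \<in> firms m \<Longrightarrow> \<mu> i \<subseteq> workers n"
  using matched by blast

lemma feasible: "feasible_matching m n r \<mu>"
  unfolding feasible_matching_def feasible_assignment_def
  using bundle_subset capacity disj by blast

end

text \<open>The invariant inside round \<open>l\<close>.\<close>

locale round_state = round_matching +
  fixes l :: nat and S :: "nat set" and c :: "nat \<Rightarrow> nat"
  assumes remaining: "i \<in> firms m \<Longrightarrow> card (\<mu> i) + c i = r i"
    and S_available: "S \<subseteq> available_firms m c"
    and round_le: "i \<in> firms m \<Longrightarrow> h \<in> \<mu> i \<Longrightarrow> \<rho> h \<le> l"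
    and S_fresh: "i \<in> S \<Longrightarrow> h \<in> \<mu> i \<Longrightarrow> \<rho> h < l"
    and not_S: "i \<in> firms m - S \<Longrightarrow>
      (\<exists>h\<in>\<mu> i. \<rho> h = l) \<or> c i = 0 \<and> (\<forall>h\<in>\<mu> i. \<rho> h < l)"
    and previous_unmatched: "\<lbrakk>i \<in> firms m; j \<in> U; l = Suc p; 0 < a i j\<rbrakk> \<Longrightarrow>
      (\<exists>h\<in>\<mu> i. \<rho> h = p) \<or> card (\<mu> i) = r i \<and> (\<forall>h\<in>\<mu> i. \<rho> h < l)"
begin

text \<open>Only the new worker needs a fresh argument. A firm that values \<open>j0\<close> more
  than \<open>i0\<close> does is outside \<open>S\<close> by maximality. Hence it is saturated, or
  it has already picked in round \<open>l\<close>, at no smaller value since \<open>j0\<close> was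
  still unassigned.\<close>

lemma pick:
  assumes i0: "i0 \<in> S" and j0: "j0 \<in> U"
    and best: "\<forall>i\<in>S. \<forall>j\<in>U. a i j \<le> a i0 j0"
  shows "round_state m n a r (\<mu>(i0 := insert j0 (\<mu> i0))) (\<rho>(j0 := l)) (U - {j0}) l (S - {i0})
    (c(i0 := c i0 - 1))"
proof -
  let ?\<mu> = "\<mu>(i0 := insert j0 (\<mu> i0))" and ?\<rho> = "\<rho>(j0 := l)"
  have i0F: "i0 \<in> firms m" and c0: "0 < c i0"
    using i0 S_available by (auto simp: available_firms_def)
  have new: "j \<noteq> j0" if "k \<in> firms m" "j \<in> \<mu> k" for j k
    using that j0 matched by blast
  have mem: "j \<in> ?\<mu> k \<longleftrightarrow> j \<in> \<mu> k \<or> k = i0 \<and> j = j0" for j k by auto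
  have rho_old: "?\<rho> j = \<rho> j" if "k \<in> firms m" "j \<in> \<mu> k" for j k
    using new[OF that] by simp
  have fresh: "\<rho> h < l" if "h \<in> \<mu> i0" for h using S_fresh i0 that by blast
  \<comment> \<open>The bundle of a saturated firm is never the one that grows, so the saturation
    alternatives of the invariant survive the pick.\<close>
  have full: "i \<noteq> i0" if "card (\<mu> i) = r i" for i
    using that remaining[OF i0F] c0 by auto
  have cap0: "card (?\<mu> i0) = Suc (card (\<mu> i0))"
    using finite_bundle[OF i0F] new[OF i0F] by (auto intro!: card_insert_disjoint)
  have grow: "(\<exists>h\<in>?\<mu> i. ?\<rho> h = p) \<or> card (?\<mu> i) = r i \<and> (\<forall>h\<in>?\<mu> i. ?\<rho> h < q)"
    if "i \<in> firms m" "(\<exists>h\<in>\<mu> i. \<rho> h = p) \<or> card (\<mu> i) = r i \<and> (\<forall>h\<in>\<mu> i. \<rho> h < q)" for i p q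
    using that(2)
  proof
    assume "\<exists>h\<in>\<mu> i. \<rho> h = p"
    then obtain h where "h \<in> \<mu> i" "\<rho> h = p" by blast
    then have "h \<in> ?\<mu> i" "?\<rho> h = p" using rho_old[OF that(1), of h] mem by simp_all
    then show ?thesis by blast
  next
    assume *: "card (\<mu> i) = r i \<and> (\<forall>h\<in>\<mu> i. \<rho> h < q)"
    then have "i \<noteq> i0" using full by blast
    then show ?thesis using * rho_old[OF that(1)] by auto
  qed
  show ?thesis
  proof
    show "(\<Union>i\<in>firms m. ?\<mu> i) = workers n - (U - {j0})"
    proof -
      have "(\<Union>i\<in>firms m. ?\<mu> i) = insert j0 (\<Union>i\<in>firms m. \<mu> i)"
        using i0F by (auto split: if_splits)
      then show ?thesis using matched j0 unmatched by auto
    qed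
    show "U - {j0} \<subseteq> workers n" using unmatched by blast
    show "disjoint_family_on ?\<mu> (firms m)"
      unfolding disjoint_family_on_def
    proof (intro ballI impI)
      fix i k assume "i \<in> firms m" "k \<in> firms m" "i \<noteq> k"
      moreover from this have "\<mu> i \<inter> \<mu> k = {}"
        using disj by (auto simp: disjoint_family_on_def)
      ultimately show "?\<mu> i \<inter> ?\<mu> k = {}"
        using new by auto
    qed
    show "card (?\<mu> i) + (c(i0 := c i0 - 1)) i = r i" if "i \<in> firms m" for i
      using remaining[OF that] cap0 c0 by auto
    then show "card (?\<mu> i) \<le> r i" if "i \<in> firms m" for i
      using that by (metis le_add1)
    show "inj_on ?\<rho> (?\<mu> i)" if i: "i \<in> firms m" for i
    proof (cases "i = i0")
      case True
      have "inj_on ?\<rho> (\<mu> i0)"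
        using inj[OF i0F] rho_old[OF i0F] by (auto simp: inj_on_def)
      moreover have "?\<rho> j0 \<notin> ?\<rho> ` (\<mu> i0 - {j0})"
      proof
        assume "?\<rho> j0 \<in> ?\<rho> ` (\<mu> i0 - {j0})"
        then obtain h where "h \<in> \<mu> i0" "\<rho> h = l" by auto
        then show False using fresh by blast
      qed
      ultimately show ?thesis using True by simp
    next
      case False
      then show ?thesis using inj[OF i] rho_old[OF i] by (auto simp: inj_on_def)
    qed
    show "a i j \<le> a i h"
      if i: "i \<in> firms m" and k: "k \<in> firms m" and h: "h \<in> ?\<mu> i" and j: "j \<in> ?\<mu> k"
        and lt: "?\<rho> h < ?\<rho> j" for i k h j
    proof (cases "h \<in> \<mu> i")
      case True
      show ?thesis
      proof (cases "j \<in> \<mu> k")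
        case True
        then show ?thesis
          using later_le[OF i k \<open>h \<in> \<mu> i\<close>] lt rho_old[OF i \<open>h \<in> \<mu> i\<close>] rho_old[OF k] by auto
      next
        case False
        then show ?thesis using j mem unmatched_le[OF i \<open>h \<in> \<mu> i\<close> j0] by blast
      qed
    next
      case False
      \<comment> \<open>The new worker carries the latest round \<open>l\<close>, so no worker comes
        strictly after it.\<close>
      then have "h = j0" using h mem by blast
      then have "l < ?\<rho> j" using lt by simp
      moreover have "?\<rho> j \<le> l"
      proof (cases "j \<in> \<mu> k")
        case True
        then show ?thesis using round_le[OF k] rho_old[OF k] by simp
      next
        case False
        then show ?thesis using j unfolding mem by simp
      qed
      ultimately show ?thesis by simp
    qed
    show "a i j \<le> a i h" if "i \<in> firms m" "h \<in> ?\<mu> i" "j \<in> U - {j0}" for i h j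
      using that unmatched_le best i0 unfolding mem by blast
    show "(\<exists>h\<in>?\<mu> i. ?\<rho> h = ?\<rho> j \<and> a i j \<le> a i h) \<or>
      card (?\<mu> i) = r i \<and> (\<forall>h\<in>?\<mu> i. ?\<rho> h < ?\<rho> j)"
      if i: "i \<in> firms m" and k: "k \<in> firms m" and j: "j \<in> ?\<mu> k" and lt: "a k j < a i j" for i k j
    proof (cases "j \<in> \<mu> k")
      case True
      from outbid[OF i k True lt] show ?thesis
      proof
        assume "\<exists>h\<in>\<mu> i. \<rho> h = \<rho> j \<and> a i j \<le> a i h"
        then obtain h where "h \<in> \<mu> i" "\<rho> h = \<rho> j" "a i j \<le> a i h" by blast
        then have "h \<in> ?\<mu> i" "?\<rho> h = ?\<rho> j" "a i j \<le> a i h"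
          using rho_old[OF i, of h] rho_old[OF k True] mem by simp_all
        then show ?thesis by blast
      next
        assume *: "card (\<mu> i) = r i \<and> (\<forall>h\<in>\<mu> i. \<rho> h < \<rho> j)"
        then have "i \<noteq> i0" using full by blast
        then show ?thesis using * rho_old[OF i] rho_old[OF k True] by auto
      qed
    next
      case False
      then have jk: "j = j0" "k = i0" using j mem by blast+
      then have "i \<notin> S" using lt best j0 by force
      then have "(\<exists>h\<in>\<mu> i. \<rho> h = l) \<or> c i = 0 \<and> (\<forall>h\<in>\<mu> i. \<rho> h < l)"
        using not_S i by blast
      then show ?thesis
      proof
        assume "\<exists>h\<in>\<mu> i. \<rho> h = l"
        then obtain h where h: "h \<in> \<mu> i" "\<rho> h = l" by blast
        then have "?\<rho> h = ?\<rho> j" "a i j \<le> a i h" "h \<in> ?\<mu> i"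
          using unmatched_le[OF i] j0 jk by auto
        then show ?thesis by blast
      next
        assume *: "c i = 0 \<and> (\<forall>h\<in>\<mu> i. \<rho> h < l)"
        then have "i \<noteq> i0" using c0 by auto
        then show ?thesis using * rho_old[OF i] remaining[OF i] jk by auto
      qed
    qed
    show "(\<exists>h\<in>?\<mu> i. ?\<rho> h = p) \<or> card (?\<mu> i) = r i \<and> (\<forall>h\<in>?\<mu> i. ?\<rho> h < ?\<rho> j)"
      if i: "i \<in> firms m" and k: "k \<in> firms m" and j: "j \<in> ?\<mu> k" and p: "?\<rho> j = Suc p"
        and pos: "0 < a i j" for i k j p
    proof (rule grow[OF i], cases "j \<in> \<mu> k")
      case True
      then show "(\<exists>h\<in>\<mu> i. \<rho> h = p) \<or> card (\<mu> i) = r i \<and> (\<forall>h\<in>\<mu> i. \<rho> h < ?\<rho> j)"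
        using previous[OF i k True _ pos] p unfolding rho_old[OF k True] by blast
    next
      case False
      then have "j = j0" using j mem by blast
      then show "(\<exists>h\<in>\<mu> i. \<rho> h = p) \<or> card (\<mu> i) = r i \<and> (\<forall>h\<in>\<mu> i. \<rho> h < ?\<rho> j)"
        using previous_unmatched[OF i j0 _ ] p pos by auto
    qed
    show "S - {i0} \<subseteq> available_firms m (c(i0 := c i0 - 1))"
      using S_available by (auto simp: available_firms_def)
    show "?\<rho> h \<le> l" if "i \<in> firms m" "h \<in> ?\<mu> i" for i h
      using that(2) round_le[OF that(1)] rho_old[OF that(1)] unfolding mem
      by (metis fun_upd_same order.refl)
    show "?\<rho> h < l" if "i \<in> S - {i0}" "h \<in> ?\<mu> i" for i h
    proof -
      have "i \<in> firms m" using that(1) S_available by (auto simp: available_firms_def)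
      then show ?thesis using that S_fresh[of i h] rho_old[of i h] by simp
    qed
    show "(\<exists>h\<in>?\<mu> i. ?\<rho> h = l) \<or> (c(i0 := c i0 - 1)) i = 0 \<and> (\<forall>h\<in>?\<mu> i. ?\<rho> h < l)"
      if i: "i \<in> firms m - (S - {i0})" for i
    proof (cases "i = i0")
      case True
      then show ?thesis by auto
    next
      case False
      then have *: "(\<exists>h\<in>\<mu> i. \<rho> h = l) \<or> c i = 0 \<and> (\<forall>h\<in>\<mu> i. \<rho> h < l)"
        using i not_S by blast
      have "?\<rho> h = \<rho> h" if "h \<in> \<mu> i" for h using rho_old[of i h] i that by blast
      then show ?thesis using * False by simp
    qed
    show "(\<exists>h\<in>?\<mu> i. ?\<rho> h = p) \<or> card (?\<mu> i) = r i \<and> (\<forall>h\<in>?\<mu> i. ?\<rho> h < l)"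
      if "i \<in> firms m" "j \<in> U - {j0}" "l = Suc p" "0 < a i j" for i j p
      using grow[OF that(1) previous_unmatched[OF that(1) _ that(3,4)]] that(2) by blast
  qed
qed

text \<open>When the inner loop halts, a firm with positive value for a remaining worker is outside
  \<open>S\<close>. By \<open>not_S\<close> it picked in round \<open>l\<close> or is saturated,
  which is \<open>previous_unmatched\<close> for the new round.\<close>

lemma next_round:
  assumes "\<not> positive_edge a S U"
  shows "round_state m n a r \<mu> \<rho> U (Suc l) (available_firms m c) c"
proof
  show "\<rho> h \<le> Suc l" if "i \<in> firms m" "h \<in> \<mu> i" for i h
    using round_le[OF that] by simp
  show "\<rho> h < Suc l" if "i \<in> available_firms m c" "h \<in> \<mu> i" for i h
    using that round_le by (auto simp: available_firms_def less_Suc_eq_le)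
  show "(\<exists>h\<in>\<mu> i. \<rho> h = Suc l) \<or> c i = 0 \<and> (\<forall>h\<in>\<mu> i. \<rho> h < Suc l)"
    if "i \<in> firms m - available_firms m c" for i
    using that round_le by (auto simp: available_firms_def less_Suc_eq_le)
  show "(\<exists>h\<in>\<mu> i. \<rho> h = p) \<or> card (\<mu> i) = r i \<and> (\<forall>h\<in>\<mu> i. \<rho> h < Suc l)"
    if i: "i \<in> firms m" and j: "j \<in> U" and p: "Suc l = Suc p" and pos: "0 < a i j" for i j p
  proof -
    have "i \<in> firms m - S" using assms i j pos by (auto simp: positive_edge_def)
    then show ?thesis using not_S[of i] remaining[OF i] p by auto
  qed
qed (use remaining in auto)

end

lemma round_state_init:
  "round_state m n a r (\<lambda>_. {}) \<rho> (workers n) 0 (available_firms m r) r"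
  by unfold_locales (auto simp: available_firms_def disjoint_family_on_def)

text \<open>The algorithm does not record rounds. \<open>\<rho>\<close> is a history variable
  rebuilt along the run, hence the existential quantifier.\<close>

lemma round_state_picks:
  assumes "(pick_step a)\<^sup>*\<^sup>* (S, \<mu>, c, U) (S', \<mu>', c', U')"
    and "round_state m n a r \<mu> \<rho> U l S c"
  shows "\<exists>\<rho>'. round_state m n a r \<mu>' \<rho>' U' l S' c'"
  using assms
proof (induction "(S', \<mu>', c', U')" arbitrary: S' \<mu>' c' U' rule: rtranclp_induct)
  case base
  then show ?case by blast
next
  case (step st)
  obtain S1 \<mu>1 c1 U1 where st: "st = (S1, \<mu>1, c1, U1)" by (cases st)
  with step obtain \<rho>1 where "round_state m n a r \<mu>1 \<rho>1 U1 l S1 c1" by blast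
  with step(2) st show ?case by (auto elim!: pick_step.cases dest: round_state.pick)
qed

lemma round_state_rounds:
  assumes "(round_step m a)\<^sup>*\<^sup>* (\<lambda>_. {}, r, workers n) (\<mu>, c, U)"
  shows "\<exists>\<rho> l. round_state m n a r \<mu> \<rho> U l (available_firms m c) c"
  using assms
proof (induction "(\<mu>, c, U)" arbitrary: \<mu> c U rule: rtranclp_induct)
  case base
  then show ?case using round_state_init by blast
next
  case (step st)
  obtain \<mu>1 c1 U1 where st: "st = (\<mu>1, c1, U1)" by (cases st)
  with step obtain \<rho>1 l where "round_state m n a r \<mu>1 \<rho>1 U1 l (available_firms m c1) c1" by blast
  with step(2) st show ?case
    by (auto elim!: round_step.cases dest!: round_state_picks dest: round_state.next_round)
qed

section \<open>Coalition values are attained maxima\<close>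

text \<open>Assignments are arbitrary outside \<open>I\<close>, so there are infinitely many. Their
  restrictions to \<open>I\<close> form a finite function space and yield the same values.\<close>

lemma finite_assignment_values:
  fixes a :: "nat \<Rightarrow> nat \<Rightarrow> real"
  assumes "finite I" "finite T"
  shows "finite {\<Sum>i\<in>I. value_of a i (\<nu> i) | \<nu>. feasible_assignment r I T \<nu>}" (is "finite ?V")
proof (rule finite_subset)
  show "?V \<subseteq> (\<lambda>\<nu>. \<Sum>i\<in>I. value_of a i (\<nu> i)) ` (I \<rightarrow>\<^sub>E Pow T)"
  proof clarify
    fix \<nu> assume "feasible_assignment r I T \<nu>"
    then have "restrict \<nu> I \<in> I \<rightarrow>\<^sub>E Pow T" by (auto simp: feasible_assignment_def)
    then show "(\<Sum>i\<in>I. value_of a i (\<nu> i)) \<in> (\<lambda>\<nu>. \<Sum>i\<in>I. value_of a i (\<nu> i)) ` (I \<rightarrow>\<^sub>E Pow T)"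
      by (rule rev_image_eqI) simp
  qed
  show "finite ((\<lambda>\<nu>. \<Sum>i\<in>I. value_of a i (\<nu> i)) ` (I \<rightarrow>\<^sub>E Pow T))"
    using assms by (intro finite_imageI finite_PiE) auto
qed

lemma coalition_value_attained:
  assumes "finite I" "finite T"
  obtains \<nu> where "feasible_assignment r I T \<nu>"
    and "coalition_value a r I T = (\<Sum>i\<in>I. value_of a i (\<nu> i))"
proof -
  have "feasible_assignment r I T (\<lambda>_. {})"
    by (simp add: feasible_assignment_def disjoint_family_on_def)
  then have "coalition_value a r I T \<in> {\<Sum>i\<in>I. value_of a i (\<nu> i) | \<nu>. feasible_assignment r I T \<nu>}"
    unfolding coalition_value_def using finite_assignment_values[OF assms] by (intro Max_in) auto
  then show thesis using that by blast
qed

text \<open>Lets the welfare bound be read off the core inequality of the grand coalition.\<close>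

lemma opt_welfare_eq_coalition_value:
  "opt_welfare m n a r = coalition_value a r (firms m) (workers n)"
  by (simp add: opt_welfare_def coalition_value_def social_welfare_def feasible_matching_def)

lemma card_add_card_Diff: "finite B \<Longrightarrow> A \<subseteq> B \<Longrightarrow> card A + card (B - A) = card B"
  by (simp add: card_Diff_subset card_mono finite_subset)

section \<open>Fairness, core and welfare guarantees of the output\<close>

text \<open>\<open>exhausted\<close> is the halting condition of the outer loop, expressed without
  the remaining capacities \<open>c\<close>.\<close>

locale round_output = round_matching +
  assumes nonneg: "i \<in> firms m \<Longrightarrow> j \<in> workers n \<Longrightarrow> 0 \<le> a i j"
    and exhausted: "i \<in> firms m \<Longrightarrow> j \<in> U \<Longrightarrow> 0 < a i j \<Longrightarrow> card (\<mu> i) = r i"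
begin

lemma value_nonneg: "i \<in> firms m \<Longrightarrow> X \<subseteq> workers n \<Longrightarrow> 0 \<le> value_of a i X"
  unfolding value_of_def using nonneg by (intro sum_nonneg) auto

text \<open>
  A worker that \<open>k\<close> got in round \<open>p + 1\<close> was still available when \<open>i\<close> picked in round \<open>p\<close>, so it
  is charged to that pick; the workers that \<open>k\<close> got after \<open>i\<close> was saturated are worth at most each
  pick of \<open>i\<close>.
\<close>

lemma EF1: "capacity_EF1 m a r \<mu>"
  unfolding capacity_EF1_def
proof (intro ballI impI)
  fix i k assume i: "i \<in> firms m" and k: "k \<in> firms m" and "\<mu> k \<noteq> {}"
  \<comment> \<open>The removed worker is the earliest pick of \<open>k\<close>. Every other pick of
    \<open>k\<close> then lies in a nonzero round and has a preceding round to charge to.\<close>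
  then obtain g where g: "g \<in> \<mu> k" and g_min: "\<And>j. j \<in> \<mu> k \<Longrightarrow> \<rho> g \<le> \<rho> j"
    using ex_has_least_nat[of "\<lambda>j. j \<in> \<mu> k" _ \<rho>] by blast
  have "value_of a i T \<le> value_of a i (\<mu> i)" if T: "T \<subseteq> \<mu> k - {g}" "card T \<le> r i" for T
  proof -
    \<comment> \<open>\<open>previous\<close> speaks about positive values only; workers worth
      \<open>0\<close> to \<open>i\<close> do not change the sum.\<close>
    define P where "P = {j \<in> T. 0 < a i j}"
    define X where "X = {j \<in> P. \<exists>h\<in>\<mu> i. Suc (\<rho> h) = \<rho> j}"
    have finT: "finite T" using T finite_bundle[OF k] finite_subset by blast
    have Pk: "j \<in> \<mu> k" "0 < a i j" if "j \<in> P" for j using that T by (auto simp: P_def)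
    have "\<forall>j\<in>X. \<exists>h. h \<in> \<mu> i \<and> Suc (\<rho> h) = \<rho> j" by (auto simp: X_def)
    from bchoice[OF this] obtain f where "\<forall>j\<in>X. f j \<in> \<mu> i \<and> Suc (\<rho> (f j)) = \<rho> j" ..
    then have f: "\<And>j. j \<in> X \<Longrightarrow> f j \<in> \<mu> i" "\<And>j. j \<in> X \<Longrightarrow> Suc (\<rho> (f j)) = \<rho> j"
      by simp_all
    have full: "card (\<mu> i) = r i \<and> (\<forall>h\<in>\<mu> i. \<rho> h < \<rho> j)" if j: "j \<in> P - X" for j
    proof -
      have jP: "j \<in> P" and "j \<noteq> g" using j T by (auto simp: P_def)
      then have "\<rho> g \<noteq> \<rho> j" using inj_onD[OF inj[OF k] _ g Pk(1)[OF jP]] by blast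
      then have "\<rho> j \<noteq> 0" using g_min[OF Pk(1)[OF jP]] by linarith
      then obtain p where p: "\<rho> j = Suc p" using not0_implies_Suc by blast
      have "\<not> (\<exists>h\<in>\<mu> i. \<rho> h = p)" using j p by (auto simp: X_def)
      then show ?thesis
        using previous[OF i k Pk(1)[OF jP] p Pk(2)[OF jP]] by blast
    qed
    \<comment> \<open>One slot per pick of \<open>i\<close> suffices, since \<open>k\<close> picks
      at most once in each round.\<close>
    have "sum (a i) (X \<union> (P - X)) \<le> real 1 * sum (a i) (\<mu> i)"
    proof (rule sum_le_by_charging[where f = f])
      show "finite X" "finite (P - X)" using finT by (auto simp: X_def P_def)
      show "finite (\<mu> i)" using finite_bundle[OF i] .
      show "0 \<le> a i h" if "h \<in> \<mu> i" for h using that nonneg[OF i] bundle_subset[OF i] by blast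
      show "a i j \<le> a i (f j)" if "j \<in> X" for j
      proof (rule later_le[OF i k f(1)[OF that]])
        show "\<rho> (f j) < \<rho> j" using f(2)[OF that] by simp
        show "j \<in> \<mu> k" using that Pk by (simp add: X_def)
      qed
      show "card {j \<in> X. f j = h} \<le> 1" for h
      proof -
        have "x = y" if "x \<in> X" "y \<in> X" "f x = f y" for x y
        proof (rule inj_onD[OF inj[OF k]])
          show "\<rho> x = \<rho> y" using that f(2)[of x] f(2)[of y] by simp
        qed (use that Pk in \<open>auto simp: X_def\<close>)
        moreover have "finite {j \<in> X. f j = h}" using finT by (auto simp: X_def P_def)
        ultimately show ?thesis by (simp add: card_le_Suc0_iff_eq)
      qed
      show "a i j \<le> a i h" if "j \<in> P - X" "h \<in> \<mu> i" for j h
        using later_le[OF i k that(2)] full[OF that(1)] that Pk by blast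
      \<comment> \<open>A worker in \<open>P - X\<close> forces \<open>i\<close> to be saturated,
        and the size limit on \<open>T\<close> is then exactly the number of picks of
        \<open>i\<close>.\<close>
      show "card X + card (P - X) \<le> 1 * card (\<mu> i)" if "P - X \<noteq> {}"
      proof -
        have "card X + card (P - X) = card P"
          using finT by (intro card_add_card_Diff) (auto simp: X_def P_def)
        also have "\<dots> \<le> card T" using finT by (intro card_mono) (auto simp: P_def)
        finally show ?thesis using full that T(2) by force
      qed
    qed (use f in auto)
    moreover have "X \<union> (P - X) = P" by (auto simp: X_def)
    moreover have "sum (a i) P = sum (a i) T"
    proof (rule sum.mono_neutral_left)
      show "\<forall>j\<in>T - P. a i j = 0"
        using T nonneg[OF i] bundle_subset[OF k] by (force simp: P_def)
    qed (use finT in \<open>auto simp: P_def\<close>)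
    ultimately show ?thesis by (simp add: value_of_def)
  qed
  moreover have "finite {value_of a i T | T. T \<subseteq> \<mu> k - {g} \<and> card T \<le> r i}"
    using finite_bundle[OF k] by (auto intro: finite_subset[of _ "value_of a i ` Pow (\<mu> k)"])
  moreover have "{value_of a i T | T. T \<subseteq> \<mu> k - {g} \<and> card T \<le> r i} \<noteq> {}"
    by (auto intro!: exI[of _ "{}"])
  ultimately have "Max {value_of a i T | T. T \<subseteq> \<mu> k - {g} \<and> card T \<le> r i} \<le> value_of a i (\<mu> i)"
    by (subst Max_le_iff) auto
  then show "\<exists>g\<in>\<mu> k. Max {value_of a i T | T. T \<subseteq> \<mu> k - {g} \<and> card T \<le> r i}
      \<le> value_of a i (\<mu> i)"
    using g by blast
qed

text \<open>By disjointness at most one summand occurs; the empty sum supplies the value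
  \<open>0\<close> for unmatched workers.\<close>

definition weight :: "nat \<Rightarrow> real" where
  "weight j = (\<Sum>k | k \<in> firms m \<and> j \<in> \<mu> k. a k j)"

lemma weight_matched: "k \<in> firms m \<Longrightarrow> j \<in> \<mu> k \<Longrightarrow> weight j = a k j"
proof -
  assume "k \<in> firms m" "j \<in> \<mu> k"
  then have "{i. i \<in> firms m \<and> j \<in> \<mu> i} = {k}"
    using disj unfolding disjoint_family_on_def by blast
  then show ?thesis by (simp add: weight_def)
qed

lemma weight_unmatched: "j \<notin> (\<Union>i\<in>firms m. \<mu> i) \<Longrightarrow> weight j = 0"
  unfolding weight_def by (rule sum.neutral) auto

lemma weight_nonneg: "j \<in> workers n \<Longrightarrow> 0 \<le> weight j"
  unfolding weight_def using nonneg by (intro sum_nonneg) auto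

lemma sum_weight_bundle: "i \<in> firms m \<Longrightarrow> sum weight (\<mu> i) = value_of a i (\<mu> i)"
  unfolding value_of_def by (intro sum.cong) (auto simp: weight_matched)

lemma sum_weight_all: "sum weight (workers n) = social_welfare m a \<mu>"
proof -
  have "sum weight (workers n) = sum weight (\<Union>i\<in>firms m. \<mu> i)"
    using matched weight_unmatched by (intro sum.mono_neutral_right) auto
  also have "\<dots> = (\<Sum>i\<in>firms m. sum weight (\<mu> i))"
    using disj finite_bundle by (intro sum.UNION_disjoint) (auto simp: disjoint_family_on_def)
  also have "\<dots> = social_welfare m a \<mu>"
    unfolding social_welfare_def by (intro sum.cong sum_weight_bundle) auto
  finally show ?thesis .
qed

text \<open>
  Workers that \<open>i\<close> values above their weight were picked after \<open>i\<close> in the same round, by at most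
  \<open>m - 1\<close> firms per round, or after \<open>i\<close> was saturated.
\<close>

lemma outbid_value_le:
  assumes m: "2 \<le> m" and i: "i \<in> firms m" and D: "D \<subseteq> workers n" "card D \<le> r i"
    and bad: "\<And>j. j \<in> D \<Longrightarrow> weight j < a i j"
  shows "value_of a i D \<le> real (min (r i) (m - 1)) * value_of a i (\<mu> i)"
proof -
  \<comment> \<open>\<open>\<rho>\<close> carries no information on \<open>U\<close>, so an
    accidental agreement of rounds has to be excluded.\<close>
  define X where "X = {j \<in> D. \<exists>h\<in>\<mu> i. \<rho> h = \<rho> j \<and> a i j \<le> a i h \<and> j \<notin> U}"
  have finD: "finite D" using D(1) finite_subset by blast
  have X_D: "X \<subseteq> D" by (auto simp: X_def)
  have "\<forall>j\<in>X. \<exists>h. h \<in> \<mu> i \<and> \<rho> h = \<rho> j \<and> a i j \<le> a i h" by (auto simp: X_def)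
  from bchoice[OF this] obtain f
    where "\<forall>j\<in>X. f j \<in> \<mu> i \<and> \<rho> (f j) = \<rho> j \<and> a i j \<le> a i (f j)" ..
  then have f: "\<And>j. j \<in> X \<Longrightarrow> f j \<in> \<mu> i" "\<And>j. j \<in> X \<Longrightarrow> \<rho> (f j) = \<rho> j"
      "\<And>j. j \<in> X \<Longrightarrow> a i j \<le> a i (f j)"
    by simp_all
  have full: "card (\<mu> i) = r i \<and> (\<forall>h\<in>\<mu> i. a i j \<le> a i h)" if j: "j \<in> D - X" for j
  proof (cases "j \<in> U")
    case True
    moreover have "0 < a i j" using bad[of j] weight_nonneg[of j] j D by force
    ultimately show ?thesis using exhausted[OF i] unmatched_le[OF i] by blast
  next
    case False
    then obtain k where k: "k \<in> firms m" "j \<in> \<mu> k" using j D matched by blast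
    then have "a k j < a i j" using bad[of j] j weight_matched by force
    from outbid[OF i k this] have "card (\<mu> i) = r i \<and> (\<forall>h\<in>\<mu> i. \<rho> h < \<rho> j)"
      using j False by (auto simp: X_def)
    then show ?thesis using later_le[OF i k(1) _ k(2)] by blast
  qed
  have cardD: "card X + card (D - X) = card D"
    using finD X_D by (intro card_add_card_Diff)
  have DX: "X \<union> (D - X) = D" using X_D by blast
  \<comment> \<open>\<open>i\<close> does not own these workers: the weight of its own workers
    equals its value for them.\<close>
  have "\<exists>k. k \<in> firms m - {i} \<and> j \<in> \<mu> k" if j: "j \<in> X" for j
  proof -
    have "j \<in> workers n - U" using j D(1) by (auto simp: X_def)
    then obtain k where k: "k \<in> firms m" "j \<in> \<mu> k" using matched by blast
    then have "k \<noteq> i" using bad[of j] j weight_matched[OF k] by (auto simp: X_def)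
    then show ?thesis using k by blast
  qed
  then have "\<forall>j\<in>X. \<exists>k. k \<in> firms m - {i} \<and> j \<in> \<mu> k" ..
  from bchoice[OF this] obtain own
    where "\<forall>j\<in>X. own j \<in> firms m - {i} \<and> j \<in> \<mu> (own j)" ..
  then have own: "\<And>j. j \<in> X \<Longrightarrow> own j \<in> firms m - {i} \<and> j \<in> \<mu> (own j)" by blast
  have hpos: "0 \<le> a i h" if "h \<in> \<mu> i" for h using that nonneg[OF i] bundle_subset[OF i] by blast
  have "sum (a i) (X \<union> (D - X)) \<le> real (m - 1) * sum (a i) (\<mu> i)"
  proof (rule sum_le_by_charging[where f = f])
    show "finite X" "finite (D - X)" using finD X_D finite_subset by auto
    show "finite (\<mu> i)" using finite_bundle[OF i] .
    \<comment> \<open>Workers charged to the same \<open>h\<close> share its round, and each other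
      firm picks at most once in that round.\<close>
    show "card {j \<in> X. f j = h} \<le> m - 1" for h
    proof -
      have "x = y" if "x \<in> X" "y \<in> X" "f x = f y" "own x = own y" for x y
      proof (rule inj_onD)
        show "inj_on \<rho> (\<mu> (own x))" using own[OF that(1)] inj by blast
        show "\<rho> x = \<rho> y" using that f(2)[of x] f(2)[of y] by simp
        show "x \<in> \<mu> (own x)" "y \<in> \<mu> (own x)" using own that by metis+
      qed
      then have "inj_on own {j \<in> X. f j = h}" by (auto simp: inj_on_def)
      then have "card {j \<in> X. f j = h} \<le> card (firms m - {i})"
        using own by (intro card_inj_on_le[of own]) auto
      then show ?thesis using i by simp
    qed
    \<comment> \<open>Here \<open>i\<close> is saturated, so its picks number at least
      \<open>card D\<close>; the factor \<open>m - 1\<close> is at least \<open>1\<close> by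
      \<open>m\<close>.\<close>
    show "card X + card (D - X) \<le> (m - 1) * card (\<mu> i)" if ne: "D - X \<noteq> {}"
    proof -
      have "card D \<le> card (\<mu> i)" using full ne D(2) by force
      also have "\<dots> \<le> (m - 1) * card (\<mu> i)" using m mult_le_mono1[of 1 "m - 1" "card (\<mu> i)"] by linarith
      finally show ?thesis using cardD by simp
    qed
  qed (use f full hpos in auto)
  then have 1: "value_of a i D \<le> real (m - 1) * value_of a i (\<mu> i)"
    by (simp only: value_of_def DX)
  \<comment> \<open>For the bound with factor \<open>r i\<close>: each worker of \<open>D\<close> is
    dominated by one pick of \<open>i\<close>, hence by the whole bundle, and \<open>D\<close> has
    at most \<open>r i\<close> elements.\<close>
  have single: "a i j \<le> value_of a i (\<mu> i)" if j: "j \<in> D" for j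
  proof -
    have "\<exists>h\<in>\<mu> i. a i j \<le> a i h"
    proof (cases "j \<in> X")
      case True
      then show ?thesis using f by blast
    next
      case False
      then have *: "card (\<mu> i) = r i" "\<forall>h\<in>\<mu> i. a i j \<le> a i h" using full[of j] j by blast+
      have "0 < card D" using j finD card_gt_0_iff by blast
      then have "\<mu> i \<noteq> {}" using * D(2) by auto
      then show ?thesis using * by blast
    qed
    then obtain h where "h \<in> \<mu> i" "a i j \<le> a i h" by blast
    moreover from this have "a i h \<le> value_of a i (\<mu> i)"
      unfolding value_of_def using finite_bundle[OF i] hpos by (intro member_le_sum) auto
    ultimately show ?thesis by linarith
  qed
  have "value_of a i D \<le> real (card D) * value_of a i (\<mu> i)"
    unfolding value_of_def[of a i D] using single by (intro sum_bounded_above)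
  also have "\<dots> \<le> real (r i) * value_of a i (\<mu> i)"
    using D(2) value_nonneg[OF i bundle_subset[OF i]] by (intro mult_right_mono) auto
  finally show ?thesis using 1 by (cases "r i \<le> m - 1") (simp_all only: min_def if_True if_False)
qed

text \<open>Only workers in \<open>D\<close> exceed their weight, and each does so by at most
  \<open>(1 - t) * a i j\<close>; the total over \<open>D\<close> is controlled by
  \<open>outbid_value_le\<close>.\<close>

lemma value_le:
  assumes m: "2 \<le> m" and i: "i \<in> firms m" and X: "X \<subseteq> workers n" "card X \<le> r i"
    and t: "0 \<le> t" "t \<le> 1" "\<And>j. j \<in> X \<Longrightarrow> t * a i j \<le> weight j"
  shows "value_of a i X
    \<le> sum weight X + (1 - t) * (real (capacity_parameter m r) * value_of a i (\<mu> i))"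
proof -
  define D where "D = {j \<in> X. weight j < a i j}"
  have fin: "finite X" using X(1) finite_subset by blast
  have DX: "D \<subseteq> X" by (auto simp: D_def)
  have "value_of a i X - sum weight X = (\<Sum>j\<in>X. a i j - weight j)"
    by (simp add: value_of_def sum_subtractf)
  also have "\<dots> \<le> (\<Sum>j\<in>X. if j \<in> D then (1 - t) * a i j else 0)"
    using t(3) by (intro sum_mono) (force simp: D_def algebra_simps)
  also have "\<dots> = (1 - t) * value_of a i D"
    using DX fin by (simp add: value_of_def sum_distrib_left sum.If_cases Int_absorb1)
  also have "\<dots> \<le> (1 - t) * (real (min (r i) (m - 1)) * value_of a i (\<mu> i))"
  proof (intro mult_left_mono outbid_value_le m i)
    show "card D \<le> r i" using card_mono[OF fin DX] X(2) by simp
  qed (use DX X t in \<open>auto simp: D_def\<close>)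
  also have "\<dots> \<le> (1 - t) * (real (capacity_parameter m r) * value_of a i (\<mu> i))"
  proof (intro mult_left_mono mult_right_mono)
    show "real (min (r i) (m - 1)) \<le> real (capacity_parameter m r)"
      unfolding capacity_parameter_def of_nat_le_iff using i by (intro Max_ge) auto
  qed (use t value_nonneg[OF i bundle_subset[OF i]] in auto)
  finally show ?thesis by simp
qed

text \<open>The per-firm bounds are summed over an optimal assignment, whose disjoint bundles have
  total weight at most that of \<open>T\<close>. \<open>\<alpha>\<close> and \<open>\<theta>\<close>
  are kept apart to cover both \<open>\<theta> = \<alpha>\<close> and
  \<open>\<theta> = 1\<close>.\<close>

lemma coalition_value_le:
  assumes \<theta>: "0 \<le> \<theta>" "\<theta> \<le> 1" and \<alpha>: "0 \<le> \<alpha>"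
    and bound: "\<And>i X. \<lbrakk>i \<in> firms m; X \<subseteq> workers n; card X \<le> r i\<rbrakk> \<Longrightarrow>
      \<alpha> * value_of a i X \<le> \<theta> * sum weight X + (1 - \<theta>) * value_of a i (\<mu> i)"
    and I: "I \<subseteq> firms m" and T: "T \<subseteq> workers n"
  shows "\<alpha> * coalition_value a r I T
    \<le> \<theta> * sum weight T + (1 - \<theta>) * (\<Sum>i\<in>I. value_of a i (\<mu> i))"
proof -
  have fin: "finite I" "finite T" using I T finite_subset by blast+
  obtain \<nu> where \<nu>: "feasible_assignment r I T \<nu>"
    and eq: "coalition_value a r I T = (\<Sum>i\<in>I. value_of a i (\<nu> i))"
    by (rule coalition_value_attained[OF fin])
  from \<nu> have sub: "\<And>i. i \<in> I \<Longrightarrow> \<nu> i \<subseteq> T" and card: "\<And>i. i \<in> I \<Longrightarrow> card (\<nu> i) \<le> r i"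
    and disj: "disjoint_family_on \<nu> I"
    by (auto simp: feasible_assignment_def)
  have "\<alpha> * coalition_value a r I T = (\<Sum>i\<in>I. \<alpha> * value_of a i (\<nu> i))"
    by (simp add: eq sum_distrib_left)
  also have "\<dots> \<le> (\<Sum>i\<in>I. \<theta> * sum weight (\<nu> i) + (1 - \<theta>) * value_of a i (\<mu> i))"
  proof (intro sum_mono bound)
    fix i assume i: "i \<in> I"
    show "i \<in> firms m" using i I by blast
    show "\<nu> i \<subseteq> workers n" using sub[OF i] T by blast
    show "card (\<nu> i) \<le> r i" using card[OF i] .
  qed
  also have "\<dots> = \<theta> * (\<Sum>i\<in>I. sum weight (\<nu> i)) + (1 - \<theta>) * (\<Sum>i\<in>I. value_of a i (\<mu> i))"
    by (simp add: sum.distrib sum_distrib_left)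
  also have "(\<Sum>i\<in>I. sum weight (\<nu> i)) = sum weight (\<Union>i\<in>I. \<nu> i)"
  proof (intro sum.UNION_disjoint[symmetric] ballI)
    show "finite (\<nu> i)" if "i \<in> I" for i using sub[OF that] fin(2) finite_subset by blast
  qed (use fin disj in \<open>auto simp: disjoint_family_on_def\<close>)
  also have "\<theta> * sum weight (\<Union>i\<in>I. \<nu> i) \<le> \<theta> * sum weight T"
  proof (intro mult_left_mono sum_mono2)
    show "(\<Union>i\<in>I. \<nu> i) \<subseteq> T" using sub by blast
    show "0 \<le> weight j" if "j \<in> T - (\<Union>i\<in>I. \<nu> i)" for j using that T weight_nonneg by blast
  qed (use fin \<theta> in auto)
  finally show ?thesis by simp
qed

text \<open>\<open>\<theta>\<close> is the share of each matched value that goes to the worker; the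
  firm keeps the rest.\<close>

lemma guarantee:
  assumes \<theta>: "0 \<le> \<theta>" "\<theta> \<le> 1" and \<alpha>: "0 \<le> \<alpha>"
    and bound: "\<And>i X. \<lbrakk>i \<in> firms m; X \<subseteq> workers n; card X \<le> r i\<rbrakk> \<Longrightarrow>
      \<alpha> * value_of a i X \<le> \<theta> * sum weight X + (1 - \<theta>) * value_of a i (\<mu> i)"
  shows "ereal \<alpha> \<le> core_ratio m n a r \<mu>"
    and "0 < opt_welfare m n a r \<Longrightarrow> \<alpha> \<le> social_welfare m a \<mu> / opt_welfare m n a r"
proof -
  note core = coalition_value_le[OF assms]
  define x where "x i = (1 - \<theta>) * value_of a i (\<mu> i)" for i
  define y where "y j = \<theta> * weight j" for j
  have "nonneg_payments m n x y"
    using \<theta> value_nonneg bundle_subset weight_nonneg by (auto simp: nonneg_payments_def x_def y_def)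
  moreover have "local_financing m n a \<mu> x y"
    by (auto simp: local_financing_def x_def y_def weight_unmatched sum_weight_bundle algebra_simps
        simp flip: sum_distrib_left)
  moreover have "in_core m n a r \<alpha> x y"
    using core by (simp add: in_core_def x_def y_def add.commute flip: sum_distrib_left)
  ultimately show "ereal \<alpha> \<le> core_ratio m n a r \<mu>"
    unfolding core_ratio_def using \<alpha> by (intro Sup_upper) blast
  \<comment> \<open>For the grand coalition the weights and the bundle values both add up to the
    welfare, so the convex combination collapses.\<close>
  have "\<alpha> * opt_welfare m n a r \<le> \<theta> * social_welfare m a \<mu> + (1 - \<theta>) * social_welfare m a \<mu>"
    using core[of "firms m" "workers n"] opt_welfare_eq_coalition_value[of m n a r]
    by (simp only: sum_weight_all order.refl simp_thms flip: social_welfare_def)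
  then show "0 < opt_welfare m n a r \<Longrightarrow> \<alpha> \<le> social_welfare m a \<mu> / opt_welfare m n a r"
    by (simp add: pos_le_divide_eq algebra_simps)
qed

lemma fractional_guarantee:
  assumes m: "2 \<le> m" and t: "0 \<le> t" "t \<le> 1"
    and tw: "\<And>i j. i \<in> firms m \<Longrightarrow> j \<in> workers n \<Longrightarrow> t * a i j \<le> weight j"
    and \<alpha>: "\<alpha> = 1 / (1 + real (capacity_parameter m r) * (1 - t))"
  shows "ereal \<alpha> \<le> core_ratio m n a r \<mu>"
    and "0 < opt_welfare m n a r \<Longrightarrow> \<alpha> \<le> social_welfare m a \<mu> / opt_welfare m n a r"
proof -
  define q where "q = real (capacity_parameter m r) * (1 - t)"
  have q: "0 \<le> q" using t by (simp add: q_def)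
  \<comment> \<open>The choice of \<open>\<alpha>\<close> balances the two sides: after scaling by
    \<open>\<alpha>\<close>, the excess \<open>q * value_of a i (\<mu> i)\<close> is exactly the
    share \<open>1 - \<alpha>\<close> kept by the firm.\<close>
  have \<alpha>q: "\<alpha> = 1 / (1 + q)" "1 - \<alpha> = \<alpha> * q" using q unfolding \<alpha> q_def[symmetric] by (simp_all add: field_simps)
  have \<alpha>01: "0 \<le> \<alpha>" "\<alpha> \<le> 1" using q \<alpha>q(1) by auto
  have bound: "\<alpha> * value_of a i X \<le> \<alpha> * sum weight X + (1 - \<alpha>) * value_of a i (\<mu> i)"
    if iX: "i \<in> firms m" "X \<subseteq> workers n" "card X \<le> r i" for i X
  proof -
    have "value_of a i X \<le> sum weight X + q * value_of a i (\<mu> i)"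
      using value_le[OF m iX t tw[OF iX(1) subsetD[OF iX(2)]]] by (simp add: q_def mult_ac)
    from mult_left_mono[OF this \<alpha>01(1)] show ?thesis
      by (simp add: \<alpha>q(2) distrib_left mult.assoc)
  qed
  show "ereal \<alpha> \<le> core_ratio m n a r \<mu>"
    using guarantee(1)[OF \<alpha>01 \<alpha>01(1) bound] .
  show "0 < opt_welfare m n a r \<Longrightarrow> \<alpha> \<le> social_welfare m a \<mu> / opt_welfare m n a r"
    using guarantee(2)[OF \<alpha>01 \<alpha>01(1) bound] .
qed

end

section \<open>The ratio \<open>delta\<close> and the final assembly\<close>

lemma delta_bounds:
  assumes nonneg: "\<forall>i\<in>firms m. \<forall>j\<in>workers n. 0 \<le> a i j"
  shows delta_nonneg: "0 \<le> delta m n a" and delta_le_1: "delta m n a \<le> 1"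
    and delta_le: "\<lbrakk>i \<in> firms m; j \<in> workers n; 0 < a i j\<rbrakk> \<Longrightarrow> delta m n a \<le> a i j / max_value m a j"
proof -
  define R where "R = {a i j / max_value m a j | i j. i \<in> firms m \<and> j \<in> workers n \<and> a i j > 0}"
  have "R \<subseteq> (\<lambda>(i, j). a i j / max_value m a j) ` (firms m \<times> workers n)"
    by (auto simp: R_def)
  then have finR: "finite R" by (rule finite_subset) simp
  have max_ge: "a i j \<le> max_value m a j" if "i \<in> firms m" for i j
    unfolding max_value_def using that by (intro Max_ge) auto
  have R01: "0 \<le> z \<and> z \<le> 1" if z: "z \<in> R" for z
  proof -
    obtain i j where "z = a i j / max_value m a j" "i \<in> firms m" "0 < a i j"
      using z by (auto simp: R_def)
    then show ?thesis using max_ge[of i j] by (auto simp: divide_le_eq)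
  qed
  \<comment> \<open>The default \<open>1\<close> covers the market without positive values, where
    there is no ratio to minimise.\<close>
  have d: "delta m n a = (if R = {} then 1 else Min R)"
    by (auto simp: delta_def R_def)
  show "0 \<le> delta m n a" "delta m n a \<le> 1"
    using R01 Min_in[OF finR] by (auto simp: d)
  show "delta m n a \<le> a i j / max_value m a j"
    if "i \<in> firms m" "j \<in> workers n" "0 < a i j" for i j
  proof -
    have "a i j / max_value m a j \<in> R" using that by (auto simp: R_def)
    then show ?thesis using finR by (auto simp: d)
  qed
qed

lemma algorithm_output_round_output:
  assumes "\<forall>i\<in>firms m. \<forall>j\<in>workers n. 0 \<le> a i j" and "algorithm_output m n a r \<mu>"
  shows "\<exists>\<rho> U. round_output m n a r \<mu> \<rho> U"
proof -
  obtain c U where steps: "(round_step m a)\<^sup>*\<^sup>* (\<lambda>_. {}, r, workers n) (\<mu>, c, U)"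
    and stop: "\<not> positive_edge a (available_firms m c) U"
    using assms(2) by (auto simp: algorithm_output_def)
  obtain \<rho> l where "round_state m n a r \<mu> \<rho> U l (available_firms m c) c"
    using round_state_rounds[OF steps] by blast
  then interpret round_state m n a r \<mu> \<rho> U l "available_firms m c" c .
  \<comment> \<open>The halting condition forces \<open>c i = 0\<close>, which
    \<open>remaining\<close> turns into saturation.\<close>
  have "card (\<mu> i) = r i" if "i \<in> firms m" "j \<in> U" "0 < a i j" for i j
    using that stop remaining[OF that(1)] by (auto simp: positive_edge_def available_firms_def)
  then have "round_output m n a r \<mu> \<rho> U"
    using assms(1) by unfold_locales auto
  then show ?thesis by blast
qed

theorem theorem15:
  fixes m n :: nat and a :: "nat \<Rightarrow> nat \<Rightarrow> real" and r :: "nat \<Rightarrow> nat"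
    and \<mu> :: "nat \<Rightarrow> nat set"
  assumes "m \<ge> 2"
    and "\<forall>i\<in>firms m. \<forall>j\<in>workers n. a i j \<ge> 0"
    and "algorithm_output m n a r \<mu>"
  shows "feasible_matching m n r \<mu>
    \<and> capacity_EF1 m a r \<mu>
    \<and> core_ratio m n a r \<mu> \<ge> ereal (1 / (1 + real (capacity_parameter m r)))
    \<and> (opt_welfare m n a r > 0 \<longrightarrow>
         social_welfare m a \<mu> / opt_welfare m n a r \<ge> 1 / (1 + real (capacity_parameter m r)))
    \<and> ((\<forall>j\<in>workers n. max_value m a j > 0 \<longrightarrow> (\<exists>i\<in>firms m. j \<in> \<mu> i \<and> a i j > 0)) \<longrightarrow>
         core_ratio m n a r \<mu> \<ge> ereal (Gamma_bound m r (delta m n a))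
         \<and> (opt_welfare m n a r > 0 \<longrightarrow>
              min (core_ratio m n a r \<mu>) (ereal (social_welfare m a \<mu> / opt_welfare m n a r))
                \<ge> ereal (Gamma_bound m r (delta m n a))))"
proof -
  note m = assms(1) and values_nonneg = assms(2)
  obtain \<rho> U where "round_output m n a r \<mu> \<rho> U"
    using algorithm_output_round_output[OF assms(2,3)] by blast
  then interpret round_output m n a r \<mu> \<rho> U .
  let ?t = "delta m n a" and ?q = "real (capacity_parameter m r)"
  \<comment> \<open>With \<open>t = 0\<close> the condition on weights is just their
    nonnegativity.\<close>
  have general: "ereal (1 / (1 + ?q)) \<le> core_ratio m n a r \<mu>"
    "0 < opt_welfare m n a r \<Longrightarrow> 1 / (1 + ?q) \<le> social_welfare m a \<mu> / opt_welfare m n a r"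
    using fractional_guarantee[OF m, of 0 "1 / (1 + ?q)"] weight_nonneg by auto
  have full: "ereal (Gamma_bound m r ?t) \<le> core_ratio m n a r \<mu>"
    "0 < opt_welfare m n a r \<Longrightarrow>
      Gamma_bound m r ?t \<le> social_welfare m a \<mu> / opt_welfare m n a r"
    if all: "\<forall>j\<in>workers n. max_value m a j > 0 \<longrightarrow> (\<exists>i\<in>firms m. j \<in> \<mu> i \<and> a i j > 0)"
  proof -
    note t0 = delta_nonneg[OF values_nonneg] and t1 = delta_le_1[OF values_nonneg]
    \<comment> \<open>A worker with positive maximum is matched along an edge worth at least
      \<open>?t\<close> times that maximum; any other worker has only zero values.\<close>
    have tw: "?t * a i j \<le> weight j" if i: "i \<in> firms m" and j: "j \<in> workers n" for i j
    proof -
      have le: "a i j \<le> max_value m a j"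
        unfolding max_value_def using i by (intro Max_ge) auto
      show ?thesis
      proof (cases "0 < max_value m a j")
        case True
        then obtain k where k: "k \<in> firms m" "j \<in> \<mu> k" "0 < a k j" using all j by blast
        have "?t * a i j \<le> ?t * max_value m a j" using le t0 by (intro mult_left_mono)
        also have "\<dots> \<le> a k j"
          using delta_le[OF values_nonneg k(1) j k(3)] True by (simp add: pos_le_divide_eq)
        also have "\<dots> = weight j" using weight_matched[OF k(1,2)] by simp
        finally show ?thesis .
      next
        case False
        then have "a i j = 0" using le nonneg[OF i j] by force
        then show ?thesis using weight_nonneg[OF j] by simp
      qed
    qed
    \<comment> \<open>With \<open>\<theta> = 1\<close> all value goes to the workers, which gives
      the ratio \<open>?t\<close>. The maximum in \<open>Gamma_bound\<close> comes from the better
      of this scheme and the fractional one.\<close>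
    have bound: "?t * value_of a i X \<le> 1 * sum weight X + (1 - 1) * value_of a i (\<mu> i)"
      if "i \<in> firms m" "X \<subseteq> workers n" for i X
      using that tw by (auto simp: value_of_def sum_distrib_left intro!: sum_mono)
    show "ereal (Gamma_bound m r ?t) \<le> core_ratio m n a r \<mu>"
      using guarantee(1)[OF _ _ t0 bound] fractional_guarantee(1)[OF m t0 t1 tw refl]
      by (simp add: Gamma_bound_def max_def)
    show "0 < opt_welfare m n a r \<Longrightarrow>
        Gamma_bound m r ?t \<le> social_welfare m a \<mu> / opt_welfare m n a r"
      using guarantee(2)[OF _ _ t0 bound] fractional_guarantee(2)[OF m t0 t1 tw refl]
      by (simp add: Gamma_bound_def)
  qed
  show ?thesis
    using feasible EF1 general full by simp
qed

end
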